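(* Let $n>3$. The edge set of the complete graph $K_n$ can be partitioned into $\lceil 3n/4\rceil$ $2$-star-forests, and it cannot be partitioned into fewer than $\lceil 3n/4\rceil$ $2$-star-forests.
   Context: A star is a graph consisting of a vertex together with some edges incident to it (a single vertex counts as a star). A star-forest is a graph every connected component of which is a star. A $k$-star-forest is a star-forest with at most $k$ connected components. *)

theory Defs
  imports Complex_Main "HOL-Library.Disjoint_Sets"
begin

text \<open>A finite simple graph is given by its vertex set \<open>V\<close> and its edge set \<open>E\<close>, an edge
  being a two-element set of vertices.\<close>

definition all_edges :: "'a set \<Rightarrow> 'a set set" where
  "all_edges V = {e. e \<subseteq> V \<and> card e = 2}"

definition simple_graph :: "'a set \<Rightarrow> 'a set set \<Rightarrow> bool" where
  "simple_graph V E \<longleftrightarrow> finite V \<and> E \<subseteq> all_edges V"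

definition reachable :: "'a set \<Rightarrow> 'a set set \<Rightarrow> ('a \<times> 'a) set" where
  "reachable V E = {(u, v). u \<in> V \<and> v \<in> V \<and> (u, v) \<in> {(x, y). {x, y} \<in> E}\<^sup>*}"

definition component_sets :: "'a set \<Rightarrow> 'a set set \<Rightarrow> 'a set set" where
  "component_sets V E = V // reachable V E"

definition induced_edges :: "'a set set \<Rightarrow> 'a set \<Rightarrow> 'a set set" where
  "induced_edges E C = {e \<in> E. e \<subseteq> C}"

text \<open>The set \<open>L\<close> of leaves may be empty, so a single vertex is a star.\<close>

definition is_star :: "'a set \<Rightarrow> 'a set set \<Rightarrow> bool" where
  "is_star V E \<longleftrightarrow> simple_graph V E \<and>
     (\<exists>c L. c \<notin> L \<and> V = insert c L \<and> E = (\<lambda>v. {c, v}) ` L)"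

definition star_forest :: "'a set \<Rightarrow> 'a set set \<Rightarrow> bool" where
  "star_forest V E \<longleftrightarrow> simple_graph V E \<and>
     (\<forall>C \<in> component_sets V E. is_star C (induced_edges E C))"

definition k_star_forest :: "nat \<Rightarrow> 'a set \<Rightarrow> 'a set set \<Rightarrow> bool" where
  "k_star_forest k V E \<longleftrightarrow> star_forest V E \<and> card (component_sets V E) \<le> k"

text \<open>A part is a set of edges; it counts as a \<open>k\<close>-star-forest if it is the edge set of a
  subgraph that is a \<open>k\<close>-star-forest. The vertex set \<open>W\<close> of that subgraph need not be all
  of \<open>V\<close>: vertices missed by the part are not forced to be components.\<close>

definition partitionable_into_star_forests ::
    "nat \<Rightarrow> nat \<Rightarrow> 'a set \<Rightarrow> 'a set set \<Rightarrow> bool" where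
  "partitionable_into_star_forests k m V E \<longleftrightarrow>
     (\<exists>P. partition_on E P \<and> card P = m \<and>
          (\<forall>F \<in> P. \<exists>W \<subseteq> V. k_star_forest k W F))"

end

theory Submission
  imports Defs
begin

text \<open>Fix a centre in each star of a partition into \<open>m\<close> forests, with \<open>4m < 3n\<close>. A vertex that is
  never a centre has degree at most one in every forest, which forces \<open>m \<ge> n - 1\<close>; so every vertex
  is a centre. Let \<open>A\<close> and \<open>B\<close> be the sets of vertices that are centres exactly once and exactly
  twice. An edge inside \<open>A\<close> lies in the forest centred at one of its ends, so no forest has two
  centres in \<open>A\<close>. If \<open>u \<in> B\<close> shared its two forests with \<open>v, w \<in> A\<close>, then \<open>uv\<close> and \<open>uw\<close> would
  make \<open>v\<close> and \<open>w\<close> leaves of \<open>u\<close> in each other's forests, leaving no place for \<open>vw\<close>; so \<open>u\<close> is a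
  centre of a forest without centres in \<open>A\<close>. Counting centre slots gives \<open>2m \<ge> 2|A| + |B|\<close> and
  \<open>2m \<ge> 3n - 2|A| - |B|\<close>, whence \<open>4m \<ge> 3n\<close>. An explicit construction attains the bound for
  \<open>4 dvd n\<close>, and each further vertex costs one full star.\<close>

section \<open>Star-forests as single-valued relations from leaves to centres\<close>

text \<open>A pair \<open>(x, y)\<close> stands for a leaf \<open>x\<close> attached to a centre
  \<open>y\<close>. The orientation records the choice of centre, which the edge set alone loses
  when a star is a single edge.\<close>

definition edges_of :: "('a \<times> 'a) set \<Rightarrow> 'a set set" where
  "edges_of R = (\<lambda>(x, y). {x, y}) ` R"

text \<open>Each leaf points to one centre and centres point nowhere, so the map \<open>g\<close>
  from a vertex to its centre is constant along edges. Vertices with equal \<open>g\<close> are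
  joined through that centre. Hence the components are the fibres of \<open>g\<close>, one star for
  each element of \<open>C\<close>.\<close>

lemma k_star_forest_edges_of:
  assumes fin: "finite V" and C: "C \<subseteq> V" "card C \<le> k"
    and R: "R \<subseteq> (V - C) \<times> C" "single_valued R"
  shows "k_star_forest k (C \<union> Domain R) (edges_of R)"
proof -
  define W where "W = C \<union> Domain R"
  define f where "f x = (THE y. (x, y) \<in> R)" for x
  define g where "g x = (if x \<in> C then x else f x)" for x
  have f: "f x = y" if "(x, y) \<in> R" for x y
    unfolding f_def using R(2) that by (auto dest: single_valuedD)
  have gR: "g x = y" "g y = y" "x \<notin> C" "y \<in> C" if "(x, y) \<in> R" for x y
    using R(1) f[OF that] that by (auto simp: g_def)
  have WV: "W \<subseteq> V" using C R(1) by (auto simp: W_def)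
  have finW: "finite W" using WV fin finite_subset by blast
  have gW: "g x \<in> C" "x = g x \<or> (x, g x) \<in> R" if "x \<in> W" for x
    using that f R(1) by (auto simp: W_def g_def)
  define S where "S = {(x, y). {x, y} \<in> edges_of R}"
  have S: "(x, y) \<in> S \<longleftrightarrow> (x, y) \<in> R \<or> (y, x) \<in> R" for x y
    by (force simp: S_def edges_of_def doubleton_eq_iff)
  have g_inv: "g x = g y" if "(x, y) \<in> S\<^sup>*" for x y
    using that
  proof (induction rule: rtrancl_induct)
    case (step y z)
    then show ?case using gR S by metis
  qed simp
  have reach: "reachable W (edges_of R) = {(u, v). u \<in> W \<and> v \<in> W \<and> g u = g v}"
  proof -
    have "(u, v) \<in> S\<^sup>*" if "u \<in> W" "v \<in> W" "g u = g v" for u v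
    proof -
      have "(u, g u) \<in> S\<^sup>*" "(g v, v) \<in> S\<^sup>*"
        using gW(2)[OF that(1)] gW(2)[OF that(2)] S
        by (metis r_into_rtrancl rtrancl.rtrancl_refl)+
      then show ?thesis using that(3) by (metis rtrancl_trans)
    qed
    then show ?thesis using g_inv by (auto simp: reachable_def S_def)
  qed
  define D where "D c = {x \<in> W. g x = c}" for c
  have comps: "component_sets W (edges_of R) = D ` C"
  proof -
    have "reachable W (edges_of R) `` {x} = D (g x)" if "x \<in> W" for x
      using that by (auto simp: reach D_def)
    then have "component_sets W (edges_of R) = (\<lambda>x. D (g x)) ` W"
      by (auto simp: component_sets_def quotient_def)
    also have "\<dots> = D ` (g ` W)" by (simp add: image_image)
    also have "g ` W = C"
      using gW(1) by (force simp: g_def W_def)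
    finally show ?thesis .
  qed
  have edge_ne: "x \<noteq> y" if "(x, y) \<in> R" for x y using gR[OF that] by auto
  have simple: "simple_graph W (edges_of R)"
    using finW edge_ne gR(4) by (auto simp: simple_graph_def all_edges_def edges_of_def W_def)
  have star: "is_star (D c) (induced_edges (edges_of R) (D c))" if c: "c \<in> C" for c
  proof -
    define L where "L = {x. (x, c) \<in> R}"
    have cL: "c \<notin> L" using edge_ne by (auto simp: L_def)
    have D: "D c = insert c L"
      using c gW(2) gR(1) gR(3) by (auto simp: D_def L_def W_def g_def)
    have E: "induced_edges (edges_of R) (D c) = (\<lambda>v. {c, v}) ` L"
    proof (intro equalityI subsetI)
      fix e assume "e \<in> induced_edges (edges_of R) (D c)"
      then obtain x y where xy: "(x, y) \<in> R" "e = {x, y}" "x \<in> D c"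
        by (auto simp: induced_edges_def edges_of_def)
      then have "y = c" using gR(1)[OF xy(1)] by (simp add: D_def)
      then show "e \<in> (\<lambda>v. {c, v}) ` L" using xy by (auto simp: L_def)
    next
      fix e assume "e \<in> (\<lambda>v. {c, v}) ` L"
      then obtain x where "(x, c) \<in> R" "e = {x, c}" by (auto simp: L_def)
      then show "e \<in> induced_edges (edges_of R) (D c)"
        unfolding D by (force simp: induced_edges_def edges_of_def L_def)
    qed
    have "D c \<subseteq> W" by (auto simp: D_def)
    then have "finite (D c)" using finW finite_subset by blast
    then have "simple_graph (D c) (induced_edges (edges_of R) (D c))"
      using simple by (auto simp: simple_graph_def all_edges_def induced_edges_def)
    then show ?thesis using cL D E by (auto simp: is_star_def)
  qed
  have "finite C" using C fin finite_subset by blast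
  then have "card (D ` C) \<le> k" using C(2) card_image_le le_trans by blast
  then show ?thesis
    using simple star by (simp add: k_star_forest_def star_forest_def comps flip: W_def)
qed

text \<open>Converse of the previous lemma: choose a centre in every component and point the other
  vertices of the component to it. An edge lies inside the component of its ends, hence belongs to
  that star.\<close>

lemma k_star_forestE:
  assumes "k_star_forest k W F"
  obtains C R where "C \<subseteq> W" "card C \<le> k" "R \<subseteq> (W - C) \<times> C" "single_valued R" "F = edges_of R"
proof -
  let ?r = "reachable W F"
  let ?Q = "component_sets W F"
  have simple: "finite W" "F \<subseteq> all_edges W" and card: "card ?Q \<le> k"
    and star: "\<And>D. D \<in> ?Q \<Longrightarrow> is_star D (induced_edges F D)"
    using assms by (auto simp: k_star_forest_def star_forest_def simple_graph_def)
  have "sym {(x, y). {x, y} \<in> F}" by (auto simp: sym_def insert_commute)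
  then have eq: "equiv W ?r"
    unfolding reachable_def
    by (intro equivI)
      (auto simp: refl_on_def intro!: symI transI dest: sym_rtrancl symD rtrancl_trans)
  obtain c where c: "\<And>D. D \<in> ?Q \<Longrightarrow>
      \<exists>L. c D \<notin> L \<and> D = insert (c D) L \<and> induced_edges F D = (\<lambda>v. {c D, v}) ` L"
    using star unfolding is_star_def by metis
  have cD: "c D \<in> D" if "D \<in> ?Q" for D using c[OF that] by blast
  have DW: "D \<subseteq> W" if "D \<in> ?Q" for D
    using that eq by (metis component_sets_def Union_quotient Union_upper)
  have disj: "D = D'" if "D \<in> ?Q" "D' \<in> ?Q" "x \<in> D" "x \<in> D'" for D D' x
    using quotient_disj[OF eq, of D D'] that by (auto simp: component_sets_def)
  define C where "C = c ` ?Q"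
  define R where "R = {(x, y). \<exists>D \<in> ?Q. x \<in> D \<and> x \<noteq> y \<and> y = c D}"
  have edgeR: "{x, c D} \<in> F" if D: "D \<in> ?Q" "x \<in> D" "x \<noteq> c D" for x D
  proof -
    obtain L where "D = insert (c D) L" "induced_edges F D = (\<lambda>v. {c D, v}) ` L"
      using c[OF D(1)] by blast
    then have "{c D, x} \<in> induced_edges F D" using D by auto
    then show ?thesis by (simp add: induced_edges_def insert_commute)
  qed
  show thesis
  proof
    show "C \<subseteq> W" using cD DW by (auto simp: C_def)
    have "finite ?Q" unfolding component_sets_def
      using simple(1) by (auto simp: quotient_def)
    then show "card C \<le> k" unfolding C_def using card card_image_le le_trans by blast
    show "R \<subseteq> (W - C) \<times> C"
    proof clarify
      fix x y assume "(x, y) \<in> R"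
      then obtain D where D: "D \<in> ?Q" "x \<in> D" "x \<noteq> y" "y = c D" by (auto simp: R_def)
      have "x \<notin> C"
      proof
        assume "x \<in> C"
        then obtain D' where "D' \<in> ?Q" "x = c D'" by (auto simp: C_def)
        then show False using D disj cD by metis
      qed
      then show "x \<in> W - C \<and> y \<in> C" using D DW by (auto simp: C_def)
    qed
    show "single_valued R" using disj by (auto simp: single_valued_def R_def)
    show "F = edges_of R"
    proof (intro equalityI subsetI)
      fix e assume e: "e \<in> F"
      then obtain x y where xy: "e = {x, y}" "x \<in> W" "y \<in> W"
        using simple(2) by (force simp: all_edges_def card_2_iff)
      define D where "D = ?r `` {x}"
      have D: "D \<in> ?Q" using xy by (auto simp: D_def component_sets_def quotientI)
      have "e \<subseteq> D" using e xy by (auto simp: D_def reachable_def)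
      then have "e \<in> induced_edges F D" using e by (simp add: induced_edges_def)
      then obtain L v where "D = insert (c D) L" "c D \<notin> L" "v \<in> L" "e = {v, c D}"
        using c[OF D] by (auto simp: insert_commute)
      moreover from this have "(v, c D) \<in> R" using D by (auto simp: R_def)
      ultimately show "e \<in> edges_of R" unfolding edges_of_def by (auto intro: rev_image_eqI)
    next
      fix e assume "e \<in> edges_of R"
      then show "e \<in> F" using edgeR by (auto simp: edges_of_def R_def)
    qed
  qed
qed

section \<open>Upper bound: constructing partitions\<close>

text \<open>Equal parts with distinct indices would be disjoint from themselves, hence empty.
  Nonemptiness therefore makes the indexing injective, and the number of parts is exactly
  \<open>m\<close>.\<close>

lemma partitionable_into_star_forestsI:
  assumes "finite V"
    and C: "\<And>t. t < m \<Longrightarrow> C t \<subseteq> V" "\<And>t. t < m \<Longrightarrow> card (C t) \<le> k"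
    and R: "\<And>t. t < m \<Longrightarrow> R t \<subseteq> (V - C t) \<times> C t" "\<And>t. t < m \<Longrightarrow> single_valued (R t)"
    and ne: "\<And>t. t < m \<Longrightarrow> R t \<noteq> {}"
    and disj: "\<And>t t'. t < m \<Longrightarrow> t' < m \<Longrightarrow> t \<noteq> t' \<Longrightarrow> edges_of (R t) \<inter> edges_of (R t') = {}"
    and E: "E = (\<Union>t<m. edges_of (R t))"
  shows "partitionable_into_star_forests k m V E"
proof -
  let ?F = "\<lambda>t. edges_of (R t)"
  have ne': "?F t \<noteq> {}" if "t < m" for t using ne[OF that] by (auto simp: edges_of_def)
  have inj: "inj_on ?F {..<m}"
  proof (rule inj_onI)
    fix t t' assume "t \<in> {..<m}" "t' \<in> {..<m}" "?F t = ?F t'"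
    then show "t = t'" using disj[of t t'] ne'[of t] by auto
  qed
  have "partition_on E (?F ` {..<m})"
    using E ne' disj by (auto simp: partition_on_def disjoint_def)
  moreover have "\<exists>W\<subseteq>V. k_star_forest k W (?F t)" if "t < m" for t
    using k_star_forest_edges_of[OF assms(1) C[OF that] R[OF that]] C(1)[OF that] R(1)[OF that]
    by (intro exI[of _ "C t \<union> Domain (R t)"]) auto
  ultimately show ?thesis
    unfolding partitionable_into_star_forests_def
    using card_image[OF inj] by (intro exI[of _ "?F ` {..<m}"]) auto
qed

text \<open>The new edges form the full star at \<open>v\<close>, a forest with one component, which
  is added as a part of its own.\<close>

lemma partitionable_insert_vertex:
  assumes fin: "finite V" and V: "V \<noteq> {}" "v \<notin> V" and k: "k \<ge> 1"
    and P: "partitionable_into_star_forests k m V (all_edges V)"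
  shows "partitionable_into_star_forests k (Suc m) (insert v V) (all_edges (insert v V))"
proof -
  obtain P where P: "partition_on (all_edges V) P" "card P = m"
    "\<forall>F \<in> P. \<exists>W \<subseteq> V. k_star_forest k W F"
    using P by (auto simp: partitionable_into_star_forests_def)
  define S where "S = edges_of (V \<times> {v})"
  have S: "e \<in> S \<longleftrightarrow> (\<exists>x\<in>V. e = {x, v})" for e by (auto simp: S_def edges_of_def)
  have Sdisj: "S \<inter> all_edges V = {}" using V by (auto simp: S all_edges_def)
  have SE: "S \<union> all_edges V = all_edges (insert v V)"
  proof (intro equalityI subsetI)
    fix e assume "e \<in> S \<union> all_edges V"
    then show "e \<in> all_edges (insert v V)" using V by (auto simp: S all_edges_def card_2_iff)
  next
    fix e assume "e \<in> all_edges (insert v V)"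
    then obtain x y where "e = {x, y}" "x \<noteq> y" "x \<in> insert v V" "y \<in> insert v V"
      by (auto simp: all_edges_def card_2_iff)
    then show "e \<in> S \<union> all_edges V" by (auto simp: S all_edges_def insert_commute)
  qed
  have Sne: "S \<noteq> {}" using V by (auto simp: S_def edges_of_def)
  have "finite (all_edges V)" using fin by (simp add: all_edges_def)
  then have finP: "finite P" using P(1) by (metis finite_elements)
  have subP: "F \<subseteq> all_edges V" if "F \<in> P" for F using P(1) that by (auto simp: partition_on_def)
  have SP: "S \<notin> P" using subP Sdisj Sne by blast
  have "partition_on (all_edges (insert v V)) (insert S P)"
  proof -
    have "\<Union>P = all_edges V" using P(1) by (simp add: partition_on_def)
    then have "disjnt S (\<Union>P)" using Sdisj by (simp add: disjnt_def)
    moreover have "all_edges (insert v V) - S = all_edges V" using SE Sdisj by blast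
    ultimately show ?thesis using P(1) Sne SE by (auto simp: partition_on_insert)
  qed
  moreover have "k_star_forest k ({v} \<union> Domain (V \<times> {v})) S"
    unfolding S_def using fin V k
    by (intro k_star_forest_edges_of[of "insert v V"]) (auto simp: single_valued_def)
  moreover have "{v} \<union> Domain (V \<times> {v}) \<subseteq> insert v V" by auto
  moreover have "\<forall>F\<in>P. \<exists>W\<subseteq>insert v V. k_star_forest k W F" using P(3) by blast
  moreover have "card (insert S P) = Suc m" using P(2) SP finP by simp
  ultimately show ?thesis
    unfolding partitionable_into_star_forests_def by blast
qed

text \<open>The \<open>4k\<close> vertices form \<open>k\<close> groups of four, the vertex \<open>4i + r\<close> having role \<open>r\<close> in group
  \<open>i\<close>. Group \<open>j\<close> owns three forests of types \<open>\<tau> = 0, 1, 2\<close>, centred at its roles \<open>{0, 2}\<close>,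
  \<open>{1, 3}\<close> and \<open>{2, 3}\<close>. The predicate \<open>arc \<tau> i r j s\<close> says that in the forest of type \<open>\<tau>\<close> of
  group \<open>j\<close> the vertex \<open>(i, r)\<close> is a leaf attached to the centre \<open>(j, s)\<close>. The centre counts are
  those of equality in the lower bound: roles 0 and 1 once, roles 2 and 3 twice.\<close>

definition arc :: "nat \<Rightarrow> nat \<Rightarrow> nat \<Rightarrow> nat \<Rightarrow> nat \<Rightarrow> bool" where
  "arc \<tau> i r j s \<longleftrightarrow>
    (if j < i then (\<tau>, s) \<in> {(0, 0), (1, if r = 2 then 3 else 1), (2, 2)}
     else if i < j then (\<tau>, r, s) \<in> {(0, 3, 0), (1, 3, 1), (2, 3, 3), (0, 1, 2)}
     else (\<tau>, r, s) \<in> {(0, 1, 0), (0, 3, 2), (1, 0, 3), (1, 2, 1), (2, 0, 2), (2, 1, 3)})"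

lemma nat_less_4_cases:
  assumes "(r::nat) < 4" obtains "r = 0" | "r = 1" | "r = 2" | "r = 3"
proof -
  have "r = 0 \<or> r = 1 \<or> r = 2 \<or> r = 3" using assms by linarith
  then show thesis using that by blast
qed

text \<open>Of the sixteen edges between two groups, twelve have their head in the lower group: each
  vertex of the higher group is a leaf in all three forests of the lower one. The other four start
  at role 3 (three times) and role 1 (once) of the lower group. The six edges inside a group are
  listed one by one.\<close>

lemma arc_exists:
  assumes "r < 4" "s < 4" "(i, r) \<noteq> (j, s)"
  obtains \<tau> where "\<tau> < 3" "arc \<tau> i r j s \<or> arc \<tau> j s i r"
proof -
  have "(arc 0 i r j s \<or> arc 0 j s i r) \<or> (arc 1 i r j s \<or> arc 1 j s i r) \<or>
      (arc 2 i r j s \<or> arc 2 j s i r)"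
    using assms by (elim nat_less_4_cases; cases i j rule: linorder_cases) (auto simp: arc_def)
  then show thesis using that[of 0] that[of 1] that[of 2] by auto
qed

lemma arc_simps:
  "j < i \<Longrightarrow> arc \<tau> i r j s \<longleftrightarrow>
     \<tau> = 0 \<and> s = 0 \<or> \<tau> = 1 \<and> r = 2 \<and> s = 3 \<or> \<tau> = 1 \<and> r \<noteq> 2 \<and> s = 1 \<or> \<tau> = 2 \<and> s = 2"
  "i < j \<Longrightarrow> arc \<tau> i r j s \<longleftrightarrow>
     \<tau> = 0 \<and> r = 3 \<and> s = 0 \<or> \<tau> = 1 \<and> r = 3 \<and> s = 1 \<or>
     \<tau> = 2 \<and> r = 3 \<and> s = 3 \<or> \<tau> = 0 \<and> r = 1 \<and> s = 2"
  "arc \<tau> i r i s \<longleftrightarrow>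
     \<tau> = 0 \<and> r = 1 \<and> s = 0 \<or> \<tau> = 0 \<and> r = 3 \<and> s = 2 \<or> \<tau> = 1 \<and> r = 0 \<and> s = 3 \<or>
     \<tau> = 1 \<and> r = 2 \<and> s = 1 \<or> \<tau> = 2 \<and> r = 0 \<and> s = 2 \<or> \<tau> = 2 \<and> r = 1 \<and> s = 3"
  by (auto simp: arc_def)

text \<open>Together with \<open>arc_asym\<close> this shows that an edge lies in only one forest:
  its orientation and its type are determined.\<close>

lemma arc_unique: "arc \<tau> i r j s \<Longrightarrow> arc \<tau>' i r j s \<Longrightarrow> \<tau>' = \<tau>"
  by (cases i j rule: linorder_cases; simp only: arc_simps; elim disjE conjE; simp)

text \<open>Taking both ends equal also excludes loops.\<close>

lemma arc_asym: "arc \<tau> i r j s \<Longrightarrow> \<not> arc \<tau>' j s i r"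
  by (rule notI, cases i j rule: linorder_cases; simp only: arc_simps; elim disjE conjE; simp)

lemma arc_single_valued: "arc \<tau> i r j s \<Longrightarrow> arc \<tau> i r j s' \<Longrightarrow> s = s'"
  by (cases i j rule: linorder_cases; simp only: arc_simps; elim disjE conjE; simp)

definition centre_roles :: "nat \<Rightarrow> nat set" where
  "centre_roles \<tau> = (if \<tau> = 0 then {0, 2} else if \<tau> = 1 then {1, 3} else {2, 3})"

lemma arc_head: "arc \<tau> i r j s \<Longrightarrow> s \<in> centre_roles \<tau>"
  by (cases i j rule: linorder_cases; simp only: arc_simps; elim disjE conjE;
      simp add: centre_roles_def)

text \<open>Arcs inside one group suffice, since the centres of a forest all lie in the group that
  owns it.\<close>

lemma arc_tail: "arc \<tau> i r i s \<Longrightarrow> r \<notin> centre_roles \<tau>"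
  by (simp only: arc_simps; elim disjE conjE; simp add: centre_roles_def)

lemma partitionable_four_mult:
  "partitionable_into_star_forests 2 (3 * k) {..<4 * k} (all_edges {..<4 * k})"
proof (rule partitionable_into_star_forestsI)
  \<comment> \<open>The index \<open>t\<close> encodes group \<open>t div 3\<close> and type
    \<open>t mod 3\<close>; the vertex \<open>x\<close> encodes group \<open>x div 4\<close> and
    role \<open>x mod 4\<close>.\<close>
  define C where "C t = (\<lambda>s. 4 * (t div 3) + s) ` centre_roles (t mod 3)" for t
  define R where "R t = {(x, y). x < 4 * k \<and> y < 4 * k \<and> y div 4 = t div 3 \<and>
      arc (t mod 3) (x div 4) (x mod 4) (y div 4) (y mod 4)}" for t
  have centre_iff: "x \<in> C t \<longleftrightarrow> x div 4 = t div 3 \<and> x mod 4 \<in> centre_roles (t mod 3)" for x t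
  proof -
    have "s < 4" if "s \<in> centre_roles (t mod 3)" for s
      using that by (auto simp: centre_roles_def split: if_splits)
    moreover have "x = 4 * (t div 3) + x mod 4" if "x div 4 = t div 3"
      using mult_div_mod_eq[of 4 x] that by simp
    ultimately show ?thesis unfolding C_def by (auto intro: rev_image_eqI)
  qed
  have edges_R: "{x, y} \<in> edges_of (R t) \<longleftrightarrow> (x, y) \<in> R t \<or> (y, x) \<in> R t" for x y t
    by (force simp: edges_of_def doubleton_eq_iff)
  show "finite {..<4 * k}" by simp
  show "all_edges {..<4 * k} = (\<Union>t<3 * k. edges_of (R t))"
  proof (intro equalityI subsetI)
    fix e assume "e \<in> all_edges {..<4 * k}"
    then obtain x y where xy: "e = {x, y}" "x \<noteq> y" "x < 4 * k" "y < 4 * k"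
      by (auto simp: all_edges_def card_2_iff)
    have ne: "(x div 4, x mod 4) \<noteq> (y div 4, y mod 4)"
      using xy(2) by (metis div_mult_mod_eq prod.inject)
    obtain \<tau> where \<tau>: "\<tau> < 3" "arc \<tau> (x div 4) (x mod 4) (y div 4) (y mod 4) \<or>
        arc \<tau> (y div 4) (y mod 4) (x div 4) (x mod 4)"
      using arc_exists[OF _ _ ne] by auto
    have t: "(3 * j + \<tau>) div 3 = j" "\<tau> mod 3 = \<tau>" for j
      using \<tau>(1) by auto
    have less: "3 * j + \<tau> < 3 * k" if "j < k" for j using that \<tau>(1) by linarith
    have "x div 4 < k" "y div 4 < k" using xy by auto
    note less = this[THEN less]
    \<comment> \<open>The edge goes to a forest owned by the group of its head.\<close>
    have "(x, y) \<in> R (3 * (y div 4) + \<tau>) \<or> (y, x) \<in> R (3 * (x div 4) + \<tau>)"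
      using \<tau>(2) xy by (simp add: R_def t)
    then show "e \<in> (\<Union>t<3 * k. edges_of (R t))"
      using less edges_R xy(1) by (meson UN_I lessThan_iff)
  next
    fix e assume "e \<in> (\<Union>t<3 * k. edges_of (R t))"
    then obtain t x y where xy: "(x, y) \<in> R t" "e = {x, y}" by (auto simp: edges_of_def)
    then have "x \<noteq> y" using arc_asym unfolding R_def by blast
    then show "e \<in> all_edges {..<4 * k}" using xy by (auto simp: all_edges_def R_def)
  qed
  fix t assume t: "t < 3 * k"
  have tk: "t div 3 < k" using t by (simp add: less_mult_imp_div_less mult.commute)
  show "C t \<subseteq> {..<4 * k}"
  proof
    fix x assume "x \<in> C t"
    then have "x div 4 < k" using tk centre_iff by simp
    then show "x \<in> {..<4 * k}" by simp
  qed
  have "card (C t) \<le> card (centre_roles (t mod 3))"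
    unfolding C_def by (intro card_image_le) (simp add: centre_roles_def)
  also have "\<dots> \<le> 2" by (simp add: centre_roles_def)
  finally show "card (C t) \<le> 2" .
  show "R t \<subseteq> ({..<4 * k} - C t) \<times> C t"
    using arc_head arc_tail unfolding R_def by (auto simp: centre_iff)
  show "single_valued (R t)"
  proof (rule single_valuedI)
    fix x y z assume "(x, y) \<in> R t" "(x, z) \<in> R t"
    then have "y div 4 = z div 4" "y mod 4 = z mod 4"
      using arc_single_valued by (auto simp: R_def)
    then show "y = z" by (metis div_mult_mod_eq)
  qed
  show "R t \<noteq> {}"
  proof -
    have *: "(4 * (t div 3) + r, 4 * (t div 3) + s) \<in> R t"
      if "r < 4" "s < 4" "arc (t mod 3) (t div 3) r (t div 3) s" for r s
      using that tk unfolding R_def by simp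
    \<comment> \<open>For each type one arc inside the owning group serves as witness.\<close>
    consider "t mod 3 = 0" | "t mod 3 = 1" | "t mod 3 = 2" by linarith
    then show ?thesis
      using *[of 1 0] *[of 0 3] *[of 0 2] by cases (auto simp: arc_def)
  qed
  fix t' assume t': "t' < 3 * k" "t \<noteq> t'"
  show "edges_of (R t) \<inter> edges_of (R t') = {}"
  proof (rule ccontr)
    assume "edges_of (R t) \<inter> edges_of (R t') \<noteq> {}"
    then obtain x y where xy: "(x, y) \<in> R t" "(x, y) \<in> R t' \<or> (y, x) \<in> R t'"
      using edges_R by (force simp: edges_of_def)
    \<comment> \<open>Asymmetry excludes the reversed pair and uniqueness equates the types; the
      common head \<open>y\<close> then equates the groups.\<close>
    then have "(x, y) \<in> R t'" "t mod 3 = t' mod 3"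
      using arc_unique arc_asym by (auto simp: R_def)
    then have "t div 3 = t' div 3" "t mod 3 = t' mod 3"
      using xy(1) by (auto simp: R_def)
    then show False using t'(2) by (metis div_mult_mod_eq)
  qed
qed

lemma partitionable_complete_graph:
  assumes "k \<ge> 1"
  shows "partitionable_into_star_forests 2 (3 * k + r) {..<4 * k + r} (all_edges {..<4 * k + r})"
proof (induction r)
  case 0
  show ?case using partitionable_four_mult by simp
next
  case (Suc r)
  have "{..<4 * k + r} \<noteq> {}" using assms by (simp add: lessThan_empty_iff)
  from partitionable_insert_vertex[OF _ this _ _ Suc, of "4 * k + r"]
  show ?case by (simp add: lessThan_Suc)
qed

section \<open>Lower bound: counting centre slots\<close>

text \<open>Double counting of the pairs of a forest in \<open>Q\<close> and a centre of it in
  \<open>S\<close>.\<close>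

lemma sum_card_Int_swap:
  assumes "finite Q" "finite S"
  shows "(\<Sum>F\<in>Q. card (C F \<inter> S)) = (\<Sum>v\<in>S. card {F \<in> Q. v \<in> C F})"
proof -
  have "(\<Sum>F\<in>Q. card (C F \<inter> S)) = (\<Sum>F\<in>Q. card {v \<in> S. v \<in> C F})"
    by (intro sum.cong refl arg_cong[of _ _ card]) auto
  also have "\<dots> = (\<Sum>v\<in>S. card {F \<in> Q. v \<in> C F})"
    by (rule sum_multicount_gen) (use assms in auto)
  finally show ?thesis .
qed

lemma partitionable_lower_bound:
  fixes V :: "'a set"
  assumes fin: "finite V" and n: "card V > 3"
    and part: "partitionable_into_star_forests 2 m V (all_edges V)"
  shows "3 * card V \<le> 4 * m"
proof (rule ccontr)
  assume less: "\<not> 3 * card V \<le> 4 * m"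
  obtain P where P: "partition_on (all_edges V) P" "card P = m"
    "\<forall>F \<in> P. \<exists>W \<subseteq> V. k_star_forest 2 W F"
    using part by (auto simp: partitionable_into_star_forests_def)
  have "finite (all_edges V)" using fin by (simp add: all_edges_def)
  then have finP: "finite P" using P(1) by (metis finite_elements)
  have "\<exists>C R. C \<subseteq> V \<and> card C \<le> 2 \<and> R \<subseteq> (V - C) \<times> C \<and> single_valued R \<and> F = edges_of R"
    if F: "F \<in> P" for F
  proof -
    obtain W where W: "W \<subseteq> V" "k_star_forest 2 W F" using P(3) F by blast
    obtain C R where "C \<subseteq> W" "card C \<le> 2" "R \<subseteq> (W - C) \<times> C"
      "single_valued R" "F = edges_of R"
      using W(2) by (rule k_star_forestE)
    then show ?thesis using W(1) by (intro exI[of _ C] exI[of _ R]) auto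
  qed
  then obtain C R where C: "\<And>F. F \<in> P \<Longrightarrow> C F \<subseteq> V" "\<And>F. F \<in> P \<Longrightarrow> card (C F) \<le> 2"
    and R: "\<And>F. F \<in> P \<Longrightarrow> R F \<subseteq> (V - C F) \<times> C F" "\<And>F. F \<in> P \<Longrightarrow> single_valued (R F)"
    and FR: "\<And>F. F \<in> P \<Longrightarrow> F = edges_of (R F)"
    by metis
  have edge: "\<exists>F\<in>P. (x, y) \<in> R F \<or> (y, x) \<in> R F" if "x \<in> V" "y \<in> V" "x \<noteq> y" for x y
  proof -
    have "{x, y} \<in> all_edges V" using that by (auto simp: all_edges_def)
    then obtain F where "F \<in> P" "{x, y} \<in> F" using P(1) by (auto simp: partition_on_def)
    then have "{x, y} \<in> edges_of (R F)" using FR by auto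
    then show ?thesis using \<open>F \<in> P\<close> by (force simp: edges_of_def doubleton_eq_iff)
  qed
  have RC: "x \<notin> C F" "y \<in> C F" if "F \<in> P" "(x, y) \<in> R F" for x y F
    using R(1)[OF that(1)] that(2) by auto
  define N where "N v = {F \<in> P. v \<in> C F}" for v
  have N_pos: "card (N v) \<ge> 1" if v: "v \<in> V" for v
  proof (rule ccontr)
    assume "\<not> card (N v) \<ge> 1"
    then have N: "N v = {}" using finP by (simp add: N_def not_le)
    have "\<exists>F\<in>P. (v, x) \<in> R F" if x: "x \<in> V - {v}" for x
    proof -
      obtain F where "F \<in> P" "(v, x) \<in> R F \<or> (x, v) \<in> R F" using edge[of v x] x v by auto
      then show ?thesis using RC(2)[of F x v] N by (auto simp: N_def)
    qed
    then obtain h where h: "\<And>x. x \<in> V - {v} \<Longrightarrow> h x \<in> P \<and> (v, x) \<in> R (h x)" by metis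
    \<comment> \<open>In one forest \<open>v\<close> is a leaf of at most one centre.\<close>
    have "inj_on h (V - {v})"
    proof (rule inj_onI)
      fix x y assume "x \<in> V - {v}" "y \<in> V - {v}" "h x = h y"
      then show "x = y" using h[of x] h[of y] R(2)[of "h x"] by (simp add: single_valuedD)
    qed
    then have "card (V - {v}) \<le> card P"
      using h finP by (intro card_inj_on_le) auto
    \<comment> \<open>From \<open>card V - 1 \<le> m\<close> and \<open>4 * m < 3 * card V\<close>
      it would follow that \<open>card V < 4\<close>.\<close>
    then show False using less n v fin P(2) by simp
  qed
  define A where "A = {v \<in> V. card (N v) = 1}"
  define B where "B = {v \<in> V. card (N v) = 2}"
  have A_unique: "F = G" if "v \<in> A" "F \<in> P" "G \<in> P" "v \<in> C F" "v \<in> C G" for v F G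
  proof -
    have "F \<in> N v" "G \<in> N v" using that by (auto simp: N_def)
    moreover obtain H where "N v = {H}" using \<open>v \<in> A\<close> by (auto simp: A_def card_1_singleton_iff)
    ultimately show ?thesis by simp
  qed
  have A_sep: "v = w" if vw: "v \<in> A" "w \<in> A" "F \<in> P" "v \<in> C F" "w \<in> C F" for v w F
  proof (rule ccontr)
    assume "v \<noteq> w"
    then obtain G where "G \<in> P" "(v, w) \<in> R G \<or> (w, v) \<in> R G"
      using edge vw by (auto simp: A_def)
    \<comment> \<open>The head of the edge is a centre of both \<open>G\<close> and
      \<open>F\<close>, so \<open>G = F\<close>; but then its tail is a centre of \<open>F\<close>
      as well.\<close>
    then show False using A_unique RC vw by metis
  qed
  have B_free: "\<exists>F\<in>P. C F \<inter> A = {} \<and> u \<in> C F" if u: "u \<in> B" for u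
  proof (rule ccontr)
    assume no: "\<not> ?thesis"
    obtain F G where FG: "N u = {F, G}" "F \<noteq> G"
      using u by (auto simp: B_def card_2_iff)
    then have FGP: "F \<in> P" "G \<in> P" "u \<in> C F" "u \<in> C G" by (auto simp: N_def)
    obtain v w where v: "v \<in> A" "v \<in> C F" and w: "w \<in> A" "w \<in> C G"
      using no FGP by blast
    have uA: "u \<notin> A" using u by (auto simp: A_def B_def)
    have in_V: "u \<in> V" "v \<in> V" "w \<in> V" using u v w by (auto simp: A_def B_def)
    have vw: "v \<noteq> w" using A_unique FG(2) FGP v w by blast
    have uN: "H = F \<or> H = G" if "H \<in> P" "u \<in> C H" for H using that FG by (auto simp: N_def)
    \<comment> \<open>With head \<open>v\<close> the edge would lie in \<open>F\<close>, where
      \<open>u\<close> is a centre and not a leaf. So its head is \<open>u\<close>, and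
      \<open>F\<close> is excluded because \<open>v\<close> is a centre there.\<close>
    have vG: "(v, u) \<in> R G"
    proof -
      obtain H where "H \<in> P" "(v, u) \<in> R H \<or> (u, v) \<in> R H" using edge in_V uA v by metis
      then show ?thesis using A_unique RC FGP v uN by metis
    qed
    have wF: "(w, u) \<in> R F"
    proof -
      obtain H where "H \<in> P" "(w, u) \<in> R H \<or> (u, w) \<in> R H" using edge in_V uA w by metis
      then show ?thesis using A_unique RC FGP w uN by metis
    qed
    obtain H where H: "H \<in> P" "(v, w) \<in> R H \<or> (w, v) \<in> R H" using edge in_V vw by metis
    \<comment> \<open>The head determines the forest. In \<open>G\<close>, however, \<open>v\<close>
      is already a leaf of \<open>u\<close>, and in \<open>F\<close> so is \<open>w\<close>; a
      second centre contradicts single-valuedness.\<close>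
    then have "(v, w) \<in> R G \<or> (w, v) \<in> R F" using A_unique RC FGP v w by metis
    then show False using vG wF R(2) FGP uA v w by (metis single_valuedD)
  qed
  have finAB: "finite A" "finite B" using fin by (auto simp: A_def B_def)
  have sumA: "(\<Sum>F\<in>P. card (C F \<inter> A)) = card A"
    using sum_card_Int_swap[OF finP finAB(1), of C] by (simp add: A_def N_def)
  define Q where "Q = {F \<in> P. C F \<inter> A = {}}"
  have finQ: "finite Q" using finP by (simp add: Q_def)
  have "card B \<le> (\<Sum>F\<in>Q. card (C F \<inter> B))"
  proof -
    have "card B = (\<Sum>u\<in>B. 1)" by simp
    also have "\<dots> \<le> (\<Sum>u\<in>B. card {F \<in> Q. u \<in> C F})"
    proof (rule sum_mono)
      fix u assume "u \<in> B"
      then have "{F \<in> Q. u \<in> C F} \<noteq> {}" using B_free by (auto simp: Q_def)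
      then show "1 \<le> card {F \<in> Q. u \<in> C F}"
        using finQ by (simp add: Suc_le_eq card_gt_0_iff)
    qed
    finally show ?thesis using sum_card_Int_swap[OF finQ finAB(2), of C] by simp
  qed
  also have "\<dots> = (\<Sum>F\<in>P. if C F \<inter> A = {} then card (C F \<inter> B) else 0)"
    unfolding Q_def using finP by (rule sum.inter_filter)
  \<comment> \<open>A centre in \<open>A\<close> is charged for both slots of its forest, and
    centres in \<open>B\<close> are charged only in forests without centres in \<open>A\<close>.
    This keeps the charge of every forest at most 2.\<close>
  finally have "2 * card A + card B \<le>
      (\<Sum>F\<in>P. 2 * card (C F \<inter> A) + (if C F \<inter> A = {} then card (C F \<inter> B) else 0))"
    by (simp add: sum.distrib sumA flip: sum_distrib_left)
  also have "\<dots> \<le> (\<Sum>F\<in>P. 2)"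
  proof (rule sum_mono)
    fix F assume F: "F \<in> P"
    have finC: "finite (C F)" using C(1)[OF F] fin finite_subset by blast
    have "card (C F \<inter> A) \<le> 1" using A_sep F finC by (simp add: card_le_Suc0_iff_eq)
    moreover have "card (C F \<inter> B) \<le> 2"
      using C(2)[OF F] card_mono[OF finC, of "C F \<inter> B"] by simp
    ultimately show "2 * card (C F \<inter> A) + (if C F \<inter> A = {} then card (C F \<inter> B) else 0) \<le> 2"
      by auto
  qed
  finally have ineq1: "2 * card A + card B \<le> 2 * m" using P(2) by simp
  \<comment> \<open>By \<open>N_pos\<close>, vertices outside \<open>A\<close> and \<open>B\<close>
    are centres at least three times; the two corrections lift the others to three.\<close>
  have "3 * card V \<le> (\<Sum>v\<in>V. card (N v) + (if v \<in> A then 2 else 0) + (if v \<in> B then 1 else 0))"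
  proof -
    have "3 * card V = (\<Sum>v\<in>V. 3)" by simp
    also have "\<dots> \<le> (\<Sum>v\<in>V. card (N v) + (if v \<in> A then 2 else 0) + (if v \<in> B then 1 else 0))"
    proof (rule sum_mono)
      fix v assume "v \<in> V"
      then show "3 \<le> card (N v) + (if v \<in> A then 2 else 0) + (if v \<in> B then 1 else 0)"
        using N_pos[of v] by (auto simp: A_def B_def)
    qed
    finally show ?thesis .
  qed
  also have "\<dots> = (\<Sum>v\<in>V. card (N v)) + 2 * card A + card B"
  proof -
    have "A = {v \<in> V. v \<in> A}" "B = {v \<in> V. v \<in> B}" by (auto simp: A_def B_def)
    then have "(\<Sum>v\<in>V. if v \<in> A then 2 else (0::nat)) = 2 * card A"
      "(\<Sum>v\<in>V. if v \<in> B then 1 else (0::nat)) = card B"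
      using sum.inter_filter[OF fin, of "\<lambda>_. 2::nat" "\<lambda>v. v \<in> A"]
        sum.inter_filter[OF fin, of "\<lambda>_. 1::nat" "\<lambda>v. v \<in> B"] by simp_all
    then show ?thesis by (simp add: sum.distrib)
  qed
  also have "(\<Sum>v\<in>V. card (N v)) = (\<Sum>F\<in>P. card (C F \<inter> V))"
    using sum_card_Int_swap[OF finP fin, of C] by (simp add: N_def)
  also have "\<dots> \<le> (\<Sum>F\<in>P. 2)"
    using C by (intro sum_mono) (simp add: Int_absorb2)
  finally show False using ineq1 less P(2) by simp
qed

theorem theorem2:
  fixes n :: nat
  assumes "n > 3"
  shows "partitionable_into_star_forests 2 (nat \<lceil>3 * real n / 4\<rceil>) {..<n} (all_edges {..<n})
    \<and> (\<forall>m < nat \<lceil>3 * real n / 4\<rceil>.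
          \<not> partitionable_into_star_forests 2 m {..<n} (all_edges {..<n}))"
proof
  define k r where "k = n div 4" and "r = n mod 4"
  have n: "n = 4 * k + r" "r < 4" "k \<ge> 1" using assms by (auto simp: k_def r_def)
  \<comment> \<open>The ceiling of \<open>3 * r / 4\<close> equals \<open>r\<close> exactly because
    \<open>r < 4\<close>, so one extra star for each of the \<open>r\<close> remaining vertices is
    optimal.\<close>
  have "real r \<le> 3" using n(2) by simp
  then have "\<lceil>3 * real n / 4\<rceil> = int (3 * k + r)"
    unfolding n(1) by (intro ceiling_unique) (simp_all add: field_simps)
  then have "nat \<lceil>3 * real n / 4\<rceil> = 3 * k + r" by (simp only: nat_int)
  then show "partitionable_into_star_forests 2 (nat \<lceil>3 * real n / 4\<rceil>) {..<n} (all_edges {..<n})"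
    using partitionable_complete_graph[OF n(3), of r] by (simp only: n(1))
next
  show "\<forall>m < nat \<lceil>3 * real n / 4\<rceil>.
      \<not> partitionable_into_star_forests 2 m {..<n} (all_edges {..<n})"
  proof (intro allI impI notI)
    fix m assume "m < nat \<lceil>3 * real n / 4\<rceil>"
      and part: "partitionable_into_star_forests 2 m {..<n} (all_edges {..<n})"
    then have "real m < 3 * real n / 4" by (simp add: zless_nat_eq_int_zless less_ceiling_iff)
    then show False using partitionable_lower_bound[OF _ _ part] assms by simp
  qed
qed

end
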